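(* Let $\Delta_A:=\max_{j,k}\|a_j-a_k\|_2$. Then for every $\lambda\in\mathbb R^m$ and all $u,v,w\in\mathbb R^m$, $$\|\nabla^2\phi_{\rm lse}(\lambda)\|_2\le\frac{\Delta_A^2}{4\gamma},\qquad |\nabla^3\phi_{\rm lse}(\lambda)[u,v,w]|\le\frac{\Delta_A^3}{4\gamma^2}\|u\|_2\|v\|_2\|w\|_2,$$ $$|\nabla^3\phi_{\rm lse}(\lambda)[u,u,v]|\le\frac{\Delta_A}{\gamma}\bigl(u^\top\nabla^2\phi_{\rm lse}(\lambda)u\bigr)\|v\|_2.$$ So $\phi_{\rm lse}$ has gradient Lipschitz constant $L_{\rm lse}\le\Delta_A^2/(4\gamma)$, is quasi-self-concordant with parameter $M_{\rm qsc}\le\Delta_A/\gamma$, and has Hessian Lipschitz constant $M_2\le\Delta_A^3/(4\gamma^2)$.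
   Context: Let $A\in\mathbb R^{m\times n}$ with columns $a_1,\dots,a_n$, $b\in\mathbb R^m$, $c\in\mathbb R^n$, $\gamma>0$; standing assumption of the paper: there is $q\in\mathbb R^m$ with $A^\top q=\mathbf 1$, $\langle q,b\rangle=1$, and there is $\bar x>0$ (entrywise) with $A\bar x=b$. The log-sum-exp dual is $\phi_{\rm lse}(\lambda)=-\langle b,\lambda\rangle+\gamma\log\sum_{j=1}^n\exp((a_j^\top\lambda-c_j)/\gamma)$. A convex $C^3$ function $f$ is quasi-self-concordant with parameter $M_{\rm qsc}$ if $|\nabla^3f(\lambda)[u,u,v]|\le M_{\rm qsc}\,(u^\top\nabla^2f(\lambda)u)\,\|v\|_2$ for all $\lambda,u,v$. Lipschitz constants are with respect to the Euclidean norm (and spectral norm for Hessians). *)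

theory Defs
  imports "HOL-Analysis.Analysis"
begin

definition lse_dual ::
  "real ^ 'n ^ 'm \<Rightarrow> real ^ 'm \<Rightarrow> real ^ 'n \<Rightarrow> real \<Rightarrow> real ^ 'm \<Rightarrow> real" where
  "lse_dual A b c \<gamma> y =
     - (b \<bullet> y) + \<gamma> * ln (\<Sum>j\<in>UNIV. exp ((column j A \<bullet> y - c $ j) / \<gamma>))"

definition column_diameter :: "real ^ 'n ^ 'm \<Rightarrow> real" where
  "column_diameter A = Max {norm (column j A - column k A) | j k. True}"

definition gradient :: "('a::real_inner \<Rightarrow> real) \<Rightarrow> 'a \<Rightarrow> 'a" where
  "gradient f x = (THE g. GDERIV f x :> g)"

definition hessian :: "(real ^ 'm \<Rightarrow> real) \<Rightarrow> real ^ 'm \<Rightarrow> real ^ 'm ^ 'm" where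
  "hessian f x = jacobian (gradient f) (at x)"

text \<open>The trilinear form of the third derivative: the matrix-valued map \<^term>\<open>hessian f\<close> is
  differentiated in direction \<open>w\<close>, and the resulting matrix is paired with \<open>u\<close> and \<open>v\<close>.\<close>

definition third_derivative ::
  "(real ^ 'm \<Rightarrow> real) \<Rightarrow> real ^ 'm \<Rightarrow> real ^ 'm \<Rightarrow> real ^ 'm \<Rightarrow> real ^ 'm \<Rightarrow> real" where
  "third_derivative f x u v w = u \<bullet> (frechet_derivative (hessian f) (at x) w *v v)"

text \<open>The functions \<^const>\<open>gradient\<close>, \<^const>\<open>hessian\<close> and \<^const>\<open>third_derivative\<close> are total and
  unspecified where the derivative in question does not exist; the following predicate guarantees
  existence. In finite dimension, continuity of the third derivative is continuity of all its
  evaluations.\<close>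

definition C3 :: "(real ^ 'm \<Rightarrow> real) \<Rightarrow> bool" where
  "C3 f \<longleftrightarrow>
     (\<forall>x. f differentiable (at x)) \<and>
     (\<forall>x. gradient f differentiable (at x)) \<and>
     (\<forall>x. hessian f differentiable (at x)) \<and>
     (\<forall>u v w. continuous_on UNIV (\<lambda>x. third_derivative f x u v w))"

definition spectral_norm :: "real ^ 'n ^ 'm \<Rightarrow> real" where
  "spectral_norm M = onorm (\<lambda>x. M *v x)"

definition quasi_self_concordant :: "real \<Rightarrow> (real ^ 'm \<Rightarrow> real) \<Rightarrow> bool" where
  "quasi_self_concordant M f \<longleftrightarrow>
     convex_on UNIV f \<and> C3 f \<and>
     (\<forall>x u v. \<bar>third_derivative f x u u v\<bar> \<le> M * (u \<bullet> (hessian f x *v u)) * norm v)"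

text \<open>The distance between Hessians is measured in the spectral norm, whereas the norm of the type
  \<^typ>\<open>real ^ 'm ^ 'm\<close> is the Frobenius norm; hence \<^const>\<open>lipschitz_on\<close> does not apply.\<close>

definition hessian_lipschitz :: "real \<Rightarrow> (real ^ 'm \<Rightarrow> real) \<Rightarrow> bool" where
  "hessian_lipschitz L f \<longleftrightarrow>
     0 \<le> L \<and> (\<forall>x y. spectral_norm (hessian f x - hessian f y) \<le> L * norm (x - y))"

end

theory Submission
  imports Defs
begin

text \<open>
  Up to an affine term, the log-sum-exp dual at \<open>y\<close> is \<open>\<gamma>\<close> times the cumulant generating
  function, at \<open>y / \<gamma>\<close>, of a random column of \<open>A\<close>, so its derivatives are cumulants of the
  exponentially tilted distribution. Let \<open>p\<close> be the softmax
  weights of the scores \<open>(a\<^sub>j \<bullet> y - c\<^sub>j) / \<gamma>\<close>, let \<open>\<mu>\<close> be the mean of the columns under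
  \<open>p\<close>, and write \<open>d\<^sub>j = a\<^sub>j - \<mu>\<close>. Then
  \<^item> the gradient is \<open>\<mu> - b\<close>;
  \<^item> the Hessian form at \<open>u, v\<close> is \<open>1/\<gamma>\<close> times the covariance
    \<open>\<Sum>\<^sub>j p\<^sub>j (d\<^sub>j \<bullet> u) (d\<^sub>j \<bullet> v)\<close>;
  \<^item> the third derivative at \<open>u, v, w\<close> is \<open>1/\<gamma>\<^sup>2\<close> times the third central moment
    \<open>\<Sum>\<^sub>j p\<^sub>j (d\<^sub>j \<bullet> u) (d\<^sub>j \<bullet> v) (d\<^sub>j \<bullet> w)\<close>.
  These formulas follow from \<open>\<partial>\<^sub>h p\<^sub>j = p\<^sub>j (d\<^sub>j \<bullet> h) / \<gamma>\<close> (\<open>softmax_has_derivative\<close>).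

  The bounds are then statements about random variables \<open>a\<^sub>j \<bullet> u\<close> whose values spread over an
  interval of length at most \<open>\<Delta> \<parallel>u\<parallel>\<close>. Popoviciu's inequality
  (\<open>variance_le_quarter_range_squared\<close>) bounds the variance by a quarter of the squared length,
  and Cauchy-Schwarz extends this to covariances; this is where the factor \<open>1/4\<close> comes from.
  In the third moment one of the three factors satisfies \<open>\<bar>d\<^sub>j \<bullet> w\<bar> \<le> \<Delta> \<parallel>w\<parallel>\<close> and can be
  taken out of the sum, leaving an absolute second moment (\<open>softmax_third_moment_le\<close>). For
  \<open>u = v\<close> that second moment is the variance itself, that is, \<open>\<gamma>\<close> times the Hessian form, and
  this gives quasi-self-concordance. For general \<open>u, v\<close> the covariance bound applies again. The
  two Lipschitz constants follow from the pointwise bounds by the mean value inequality.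
\<close>

section \<open>Moments of a finite probability vector\<close>

text \<open>Popoviciu's inequality: the mean minimises the expected squared distance to a point, so the
  variance is at most the expected squared distance to the midpoint of the range, and no value is
  further than half the range from that midpoint.\<close>

lemma variance_le_quarter_range_squared:
  fixes p X :: "'n::finite \<Rightarrow> real"
  assumes p0: "\<And>j. 0 \<le> p j" and p1: "(\<Sum>j\<in>UNIV. p j) = 1"
    and m: "m = (\<Sum>j\<in>UNIV. p j * X j)"
    and d: "\<And>j k. X j - X k \<le> d"
  shows "(\<Sum>j\<in>UNIV. p j * (X j - m)\<^sup>2) \<le> d\<^sup>2 / 4"
proof -
  define hi where "hi = Max (range X)"
  define lo where "lo = Min (range X)"
  define t where "t = (hi + lo) / 2"
  have hi: "X j \<le> hi" and lo: "lo \<le> X j" for j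
    by (auto simp: hi_def lo_def)
  obtain k l where kl: "hi = X k" "lo = X l"
    by (metis Max_in Min_in UNIV_not_empty finite finite_imageI hi_def lo_def image_is_empty imageE)
  have range: "hi - lo \<le> d"
    using d kl by simp
  have near: "(X j - t)\<^sup>2 \<le> d\<^sup>2 / 4" for j
  proof -
    have "\<bar>X j - t\<bar> \<le> d / 2"
      using hi[of j] lo[of j] range unfolding t_def by (simp add: abs_le_iff field_simps)
    then have "\<bar>X j - t\<bar>\<^sup>2 \<le> (d / 2)\<^sup>2"
      by (rule power_mono) simp
    then show ?thesis
      by (simp add: power_divide)
  qed
  have "(\<Sum>j\<in>UNIV. p j * (X j - t)\<^sup>2)
      = (\<Sum>j\<in>UNIV. p j * (X j - m)\<^sup>2 + 2 * (m - t) * (p j * X j) + (t\<^sup>2 - m\<^sup>2) * p j)"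
    by (intro sum.cong refl) (simp add: power2_eq_square algebra_simps)
  also have "\<dots> = (\<Sum>j\<in>UNIV. p j * (X j - m)\<^sup>2) + 2 * (m - t) * m + (t\<^sup>2 - m\<^sup>2)"
    by (simp add: sum.distrib sum_distrib_left[symmetric] p1 m)
  also have "\<dots> = (\<Sum>j\<in>UNIV. p j * (X j - m)\<^sup>2) + (m - t)\<^sup>2"
    by (simp add: power2_eq_square algebra_simps)
  finally have "(\<Sum>j\<in>UNIV. p j * (X j - m)\<^sup>2) \<le> (\<Sum>j\<in>UNIV. p j * (X j - t)\<^sup>2)"
    by simp
  also have "\<dots> \<le> (\<Sum>j\<in>UNIV. p j * (d\<^sup>2 / 4))"
    by (intro sum_mono mult_left_mono near p0)
  also have "\<dots> = d\<^sup>2 / 4"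
    by (simp only: sum_distrib_right[symmetric] p1 mult_1)
  finally show ?thesis .
qed

text \<open>The absolute value stays inside the sum because the third moment is estimated term by term
  before this inequality is used.\<close>

lemma weighted_cauchy_schwarz:
  fixes p x y :: "'n::finite \<Rightarrow> real"
  assumes p0: "\<And>j. 0 \<le> p j"
    and x: "(\<Sum>j\<in>UNIV. p j * (x j)\<^sup>2) \<le> r\<^sup>2"
    and y: "(\<Sum>j\<in>UNIV. p j * (y j)\<^sup>2) \<le> s\<^sup>2"
    and "0 \<le> r" "0 \<le> s"
  shows "(\<Sum>j\<in>UNIV. p j * \<bar>x j * y j\<bar>) \<le> r * s"
proof -
  have "(\<Sum>j\<in>UNIV. (sqrt (p j) * \<bar>x j\<bar>) * (sqrt (p j) * \<bar>y j\<bar>))\<^sup>2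
      \<le> (\<Sum>j\<in>UNIV. (sqrt (p j) * \<bar>x j\<bar>)\<^sup>2) * (\<Sum>j\<in>UNIV. (sqrt (p j) * \<bar>y j\<bar>)\<^sup>2)"
    by (rule Cauchy_Schwarz_ineq_sum)
  moreover have "(sqrt (p j) * \<bar>x j\<bar>) * (sqrt (p j) * \<bar>y j\<bar>) = p j * \<bar>x j * y j\<bar>" for j
    using real_sqrt_mult_self[of "p j"] p0[of j] by (simp add: abs_mult mult_ac)
  ultimately have "(\<Sum>j\<in>UNIV. p j * \<bar>x j * y j\<bar>)\<^sup>2
      \<le> (\<Sum>j\<in>UNIV. p j * (x j)\<^sup>2) * (\<Sum>j\<in>UNIV. p j * (y j)\<^sup>2)"
    using p0 by (simp add: power_mult_distrib)
  also have "\<dots> \<le> r\<^sup>2 * s\<^sup>2"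
    by (intro mult_mono x y sum_nonneg mult_nonneg_nonneg p0) auto
  also have "\<dots> = (r * s)\<^sup>2"
    by (simp add: power_mult_distrib)
  finally show ?thesis
    by (rule power2_le_imp_le) (simp add: assms)
qed

section \<open>Softmax weights\<close>

definition softmax ::
  "('n::finite \<Rightarrow> 'a::real_inner) \<Rightarrow> ('n \<Rightarrow> real) \<Rightarrow> real \<Rightarrow> 'a \<Rightarrow> 'n \<Rightarrow> real" where
  "softmax a c \<gamma> y j =
     exp ((a j \<bullet> y - c j) / \<gamma>) / (\<Sum>k\<in>UNIV. exp ((a k \<bullet> y - c k) / \<gamma>))"

definition softmax_mean ::
  "('n::finite \<Rightarrow> 'a::real_inner) \<Rightarrow> ('n \<Rightarrow> real) \<Rightarrow> real \<Rightarrow> 'a \<Rightarrow> 'a" where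
  "softmax_mean a c \<gamma> y = (\<Sum>j\<in>UNIV. softmax a c \<gamma> y j *\<^sub>R a j)"

definition deviation ::
  "('n::finite \<Rightarrow> 'a::real_inner) \<Rightarrow> ('n \<Rightarrow> real) \<Rightarrow> real \<Rightarrow> 'a \<Rightarrow> 'n \<Rightarrow> 'a" where
  "deviation a c \<gamma> y j = a j - softmax_mean a c \<gamma> y"

lemma sum_exp_pos: "0 < (\<Sum>k\<in>(UNIV::'n::finite set). exp (f k :: real))"
  by (intro sum_pos) auto

lemma softmax_pos: "0 < softmax a c \<gamma> y j"
  by (simp add: softmax_def sum_exp_pos)

lemma sum_softmax: "(\<Sum>j\<in>UNIV. softmax a c \<gamma> y j) = 1"
  using sum_exp_pos[of "\<lambda>k. (a k \<bullet> y - c k) / \<gamma>"]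
  by (simp add: softmax_def sum_divide_distrib[symmetric])

lemma sum_softmax_deviation: "(\<Sum>j\<in>UNIV. softmax a c \<gamma> y j *\<^sub>R deviation a c \<gamma> y j) = 0"
  by (simp add: deviation_def scaleR_diff_right sum_subtractf scaleR_sum_left[symmetric]
      sum_softmax flip: softmax_mean_def)

lemma deviation_inner_eq:
  "deviation a c \<gamma> y j \<bullet> u = a j \<bullet> u - (\<Sum>k\<in>UNIV. softmax a c \<gamma> y k * (a k \<bullet> u))"
  by (simp add: deviation_def softmax_mean_def inner_diff_left inner_sum_left)

lemma exp_affine_has_derivative:
  fixes a :: "'n \<Rightarrow> 'a::real_inner"
  shows "((\<lambda>y. exp ((a k \<bullet> y - c k) / \<gamma>)) has_derivative
    (\<lambda>h. exp ((a k \<bullet> y - c k) / \<gamma>) * ((a k \<bullet> h) / \<gamma>))) (at y)"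
  unfolding divide_inverse by (auto intro!: derivative_eq_intros)

text \<open>The logarithmic derivative of the partition function is the softmax mean, up to \<open>1/\<gamma>\<close>.\<close>

lemma sum_exp_has_derivative:
  "((\<lambda>y. \<Sum>k\<in>UNIV. exp ((a k \<bullet> y - c k) / \<gamma>)) has_derivative
    (\<lambda>h. (\<Sum>k\<in>UNIV. exp ((a k \<bullet> y - c k) / \<gamma>)) * (softmax_mean a c \<gamma> y \<bullet> h) / \<gamma>)) (at y)"
proof -
  let ?Z = "\<Sum>k\<in>UNIV. exp ((a k \<bullet> y - c k) / \<gamma>)"
  have Z: "?Z \<noteq> 0"
    using sum_exp_pos[of "\<lambda>k. (a k \<bullet> y - c k) / \<gamma>"] by simp
  have "(\<Sum>k\<in>UNIV. exp ((a k \<bullet> y - c k) / \<gamma>) * ((a k \<bullet> h) / \<gamma>))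
      = ?Z * (softmax_mean a c \<gamma> y \<bullet> h) / \<gamma>" for h
    using Z by (simp add: softmax_mean_def softmax_def inner_sum_left sum_distrib_left sum_divide_distrib)
  then show ?thesis
    by (intro has_derivative_eq_rhs[OF has_derivative_sum[OF exp_affine_has_derivative]]) simp
qed

lemma softmax_has_derivative:
  "((\<lambda>y. softmax a c \<gamma> y j) has_derivative
    (\<lambda>h. softmax a c \<gamma> y j * (deviation a c \<gamma> y j \<bullet> h) / \<gamma>)) (at y)"
proof -
  have Z: "(\<Sum>k\<in>UNIV. exp ((a k \<bullet> y - c k) / \<gamma>)) \<noteq> 0"
    using sum_exp_pos[of "\<lambda>k. (a k \<bullet> y - c k) / \<gamma>"] by simp
  show ?thesis
    unfolding softmax_def
    by (rule has_derivative_eq_rhs[OF has_derivative_divide'[OF exp_affine_has_derivative sum_exp_has_derivative Z]])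
      (use Z in \<open>simp add: fun_eq_iff deviation_def inner_diff_left divide_simps, simp add: algebra_simps\<close>)
qed

text \<open>Differentiating the weights gives \<open>\<Sum>\<^sub>j p\<^sub>j (d\<^sub>j \<bullet> h) a\<^sub>j / \<gamma>\<close>. Since the coefficients
  \<open>p\<^sub>j (d\<^sub>j \<bullet> h)\<close> sum to zero, each column \<open>a\<^sub>j\<close> may be replaced by its deviation \<open>d\<^sub>j\<close>,
  which exhibits the derivative as the covariance operator.\<close>

lemma softmax_mean_has_derivative:
  "(softmax_mean a c \<gamma> has_derivative
    (\<lambda>h. \<Sum>j\<in>UNIV. (softmax a c \<gamma> y j * (deviation a c \<gamma> y j \<bullet> h) / \<gamma>) *\<^sub>R deviation a c \<gamma> y j)) (at y)"
proof -
  have centre: "(\<Sum>j\<in>UNIV. (softmax a c \<gamma> y j * (deviation a c \<gamma> y j \<bullet> h) / \<gamma>) *\<^sub>R a j)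
      = (\<Sum>j\<in>UNIV. (softmax a c \<gamma> y j * (deviation a c \<gamma> y j \<bullet> h) / \<gamma>) *\<^sub>R deviation a c \<gamma> y j)" for h
  proof -
    have "(\<Sum>j\<in>UNIV. softmax a c \<gamma> y j * (deviation a c \<gamma> y j \<bullet> h) / \<gamma>)
        = ((\<Sum>j\<in>UNIV. softmax a c \<gamma> y j *\<^sub>R deviation a c \<gamma> y j) \<bullet> h) / \<gamma>"
      by (simp add: inner_sum_left sum_divide_distrib)
    also have "\<dots> = 0"
      by (simp add: sum_softmax_deviation)
    finally have "(\<Sum>j\<in>UNIV. (softmax a c \<gamma> y j * (deviation a c \<gamma> y j \<bullet> h) / \<gamma>) *\<^sub>R softmax_mean a c \<gamma> y) = 0"
      by (simp flip: scaleR_sum_left)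
    then show ?thesis
      by (simp only: deviation_def scaleR_diff_right sum_subtractf) simp
  qed
  have "((\<lambda>y. \<Sum>j\<in>UNIV. softmax a c \<gamma> y j *\<^sub>R a j) has_derivative
    (\<lambda>h. \<Sum>j\<in>UNIV. (softmax a c \<gamma> y j * (deviation a c \<gamma> y j \<bullet> h) / \<gamma>) *\<^sub>R a j)) (at y)"
    by (intro has_derivative_sum has_derivative_scaleR_left softmax_has_derivative)
  then show ?thesis
    unfolding centre softmax_mean_def[abs_def] .
qed

lemma deviation_has_derivative:
  "((\<lambda>y. deviation a c \<gamma> y k) has_derivative
    (\<lambda>h. - (\<Sum>j\<in>UNIV. (softmax a c \<gamma> y j * (deviation a c \<gamma> y j \<bullet> h) / \<gamma>) *\<^sub>R deviation a c \<gamma> y j))) (at y)"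
  unfolding deviation_def[of a c \<gamma> _ k]
  using has_derivative_diff[OF has_derivative_const softmax_mean_has_derivative] by simp

section \<open>Moment bounds for softmax weights\<close>

text \<open>A deviation is a convex combination of the differences \<open>a\<^sub>j - a\<^sub>k\<close>.\<close>

lemma abs_deviation_inner_le:
  assumes d: "\<And>j k. norm (a j - a k) \<le> d"
  shows "\<bar>deviation a c \<gamma> y j \<bullet> u\<bar> \<le> d * norm u"
proof -
  have "deviation a c \<gamma> y j = (\<Sum>k\<in>UNIV. softmax a c \<gamma> y k *\<^sub>R (a j - a k))"
    by (simp add: deviation_def scaleR_diff_right sum_subtractf softmax_mean_def sum_softmax
        flip: scaleR_sum_left)
  also have "norm \<dots> \<le> (\<Sum>k\<in>UNIV. softmax a c \<gamma> y k * d)"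
    by (intro sum_norm_le) (simp add: d mult_left_mono softmax_pos less_imp_le)
  also have "\<dots> = d"
    by (simp add: sum_softmax flip: sum_distrib_right)
  finally show ?thesis
    by (meson Cauchy_Schwarz_ineq2 mult_right_mono norm_ge_zero order_trans)
qed

lemma softmax_variance_le:
  assumes d: "\<And>j k. norm (a j - a k) \<le> d"
  shows "(\<Sum>j\<in>UNIV. softmax a c \<gamma> y j * (deviation a c \<gamma> y j \<bullet> u)\<^sup>2) \<le> (d * norm u / 2)\<^sup>2"
proof -
  have "a j \<bullet> u - a k \<bullet> u \<le> d * norm u" for j k
  proof -
    have "a j \<bullet> u - a k \<bullet> u \<le> norm (a j - a k) * norm u"
      using norm_cauchy_schwarz[of "a j - a k" u] by (simp add: inner_diff_left)
    also have "\<dots> \<le> d * norm u"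
      by (simp add: d mult_right_mono)
    finally show ?thesis .
  qed
  then show ?thesis
    unfolding deviation_inner_eq
    using variance_le_quarter_range_squared[of "softmax a c \<gamma> y" _ "\<lambda>j. a j \<bullet> u" "d * norm u"]
    by (simp add: less_imp_le softmax_pos sum_softmax power_divide)
qed

lemma softmax_abs_covariance_le:
  assumes d: "\<And>j k. norm (a j - a k) \<le> d"
  shows "(\<Sum>j\<in>UNIV. softmax a c \<gamma> y j * \<bar>(deviation a c \<gamma> y j \<bullet> u) * (deviation a c \<gamma> y j \<bullet> v)\<bar>)
    \<le> d\<^sup>2 / 4 * norm u * norm v"
proof -
  have "0 \<le> d"
    using d order_trans[OF norm_ge_zero] by blast
  then have "(\<Sum>j\<in>UNIV. softmax a c \<gamma> y j * \<bar>(deviation a c \<gamma> y j \<bullet> u) * (deviation a c \<gamma> y j \<bullet> v)\<bar>)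
      \<le> (d * norm u / 2) * (d * norm v / 2)"
    by (intro weighted_cauchy_schwarz softmax_variance_le d) (auto simp: softmax_pos less_imp_le)
  then show ?thesis
    by (simp add: power2_eq_square mult_ac)
qed

text \<open>The right-hand side keeps the absolute second moment instead of its bound: with \<open>u = v\<close>
  it is the variance, which quasi-self-concordance needs.\<close>

lemma softmax_third_moment_le:
  assumes d: "\<And>j k. norm (a j - a k) \<le> d"
  shows "\<bar>\<Sum>j\<in>UNIV. softmax a c \<gamma> y j * (deviation a c \<gamma> y j \<bullet> w)
        * ((deviation a c \<gamma> y j \<bullet> u) * (deviation a c \<gamma> y j \<bullet> v))\<bar>
    \<le> d * norm w * (\<Sum>j\<in>UNIV. softmax a c \<gamma> y j
        * \<bar>(deviation a c \<gamma> y j \<bullet> u) * (deviation a c \<gamma> y j \<bullet> v)\<bar>)"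
proof -
  let ?p = "softmax a c \<gamma> y" and ?D = "deviation a c \<gamma> y"
  have "\<bar>?p j * (?D j \<bullet> w) * ((?D j \<bullet> u) * (?D j \<bullet> v))\<bar>
      \<le> d * norm w * (?p j * \<bar>(?D j \<bullet> u) * (?D j \<bullet> v)\<bar>)" for j
  proof -
    have "\<bar>?D j \<bullet> w\<bar> * (?p j * \<bar>(?D j \<bullet> u) * (?D j \<bullet> v)\<bar>)
        \<le> d * norm w * (?p j * \<bar>(?D j \<bullet> u) * (?D j \<bullet> v)\<bar>)"
      by (intro mult_right_mono abs_deviation_inner_le d) (simp add: softmax_pos less_imp_le)
    then show ?thesis
      using softmax_pos[of a c \<gamma> y j] by (simp add: abs_mult mult_ac)
  qed
  then show ?thesis
    unfolding sum_distrib_left by (intro order_trans[OF sum_abs] sum_mono)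
qed

section \<open>Derivatives of the log-sum-exp dual\<close>

definition outer_product :: "real ^ 'k \<Rightarrow> real ^ 'm \<Rightarrow> real ^ 'm ^ 'k" where
  "outer_product x y = (\<chi> i k. x $ i * y $ k)"

lemma bounded_bilinear_outer_product: "bounded_bilinear outer_product"
  unfolding bilinear_conv_bounded_bilinear[symmetric] bilinear_def
  by (auto intro!: linearI simp: outer_product_def vec_eq_iff algebra_simps)

lemma outer_product_mult_vec: "outer_product x y *v v = (y \<bullet> v) *\<^sub>R x"
  by (simp add: outer_product_def matrix_vector_mult_def vec_eq_iff inner_vec_def
      sum_distrib_left sum_distrib_right mult_ac)

lemma sum_outer_product_mult_vec:
  fixes x :: "'i \<Rightarrow> real ^ 'k" and y :: "'i \<Rightarrow> real ^ 'm"
  shows "(\<Sum>j\<in>S. r j *\<^sub>R outer_product (x j) (y j)) *v v = (\<Sum>j\<in>S. (r j * (y j \<bullet> v)) *\<^sub>R x j)"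
proof -
  have linear: "linear (\<lambda>M :: real ^ 'm ^ 'k. M *v v)"
    by (intro linearI) (simp_all add: matrix_vector_mult_add_rdistrib scaleR_matrix_vector_assoc)
  then show ?thesis
    by (simp add: linear_sum[OF linear] scaleR_matrix_vector_assoc[symmetric] outer_product_mult_vec)
qed

lemma inner_sum_outer_product_mult_vec:
  "u \<bullet> ((\<Sum>j\<in>S. r j *\<^sub>R outer_product (x j) (y j)) *v v)
    = (\<Sum>j\<in>S. r j * ((x j \<bullet> u) * (y j \<bullet> v)))"
  by (simp add: sum_outer_product_mult_vec inner_sum_right inner_commute mult_ac)

text \<open>Testing with \<open>u = M v\<close> turns a bound on the bilinear form into one on the operator norm.\<close>

lemma spectral_norm_le_bilinear:
  assumes "\<And>u v. \<bar>u \<bullet> (M *v v)\<bar> \<le> K * norm u * norm v"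
  shows "spectral_norm M \<le> K"
  unfolding spectral_norm_def
proof (rule onorm_le)
  fix v
  have "norm (M *v v) * norm (M *v v) \<le> K * norm (M *v v) * norm v"
    using assms[of "M *v v" v] by (simp add: power2_norm_eq_inner[symmetric] power2_eq_square)
  then show "norm (M *v v) \<le> K * norm v"
  proof (cases "M *v v = 0")
    case True
    \<comment> \<open>Any unit vector as left argument shows that \<open>K\<close> cannot be negative when \<open>v\<close> is nonzero.\<close>
    have "0 \<le> K * norm v"
      using order_trans[OF abs_ge_zero assms[of "axis undefined 1" v]] by (simp add: norm_axis_1)
    then show ?thesis
      using True by simp
  next
    case False
    then show ?thesis
      using \<open>norm (M *v v) * norm (M *v v) \<le> K * norm (M *v v) * norm v\<close>
      by (simp add: mult.left_commute mult.assoc)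
  qed
qed

lemma convex_on_UNIV_if_supporting_hyperplanes:
  fixes f :: "'a::real_inner \<Rightarrow> real"
  assumes support: "\<And>x y. f x + g x \<bullet> (y - x) \<le> f y"
  shows "convex_on UNIV f"
proof (rule convex_onI)
  fix t :: real and x y :: 'a
  assume t: "0 < t" "t < 1"
  let ?z = "(1 - t) *\<^sub>R x + t *\<^sub>R y"
  have "(1 - t) * (f ?z + g ?z \<bullet> (x - ?z)) + t * (f ?z + g ?z \<bullet> (y - ?z)) \<le> (1 - t) * f x + t * f y"
    using t by (intro add_mono mult_left_mono support) auto
  moreover have "(1 - t) * (f ?z + g ?z \<bullet> (x - ?z)) + t * (f ?z + g ?z \<bullet> (y - ?z)) = f ?z"
    by (simp add: inner_diff_right inner_add_right algebra_simps)
  ultimately show "f ?z \<le> (1 - t) * f x + t * f y"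
    by simp
qed simp

lemma norm_column_diff_le_column_diameter:
  "norm (column j A - column k A) \<le> column_diameter A"
proof -
  have "{norm (column j A - column k A) | j k. True}
      = range (\<lambda>(j, k). norm (column j A - column k A))"
    by auto
  then have "finite {norm (column j A - column k A) | j k. True}"
    by simp
  then show ?thesis
    unfolding column_diameter_def by (intro Max_ge) auto
qed

lemma column_diameter_nonneg: "0 \<le> column_diameter A"
  using norm_column_diff_le_column_diameter[of undefined A undefined] by simp

lemma gradient_eqI: "GDERIV f x :> g \<Longrightarrow> gradient f x = g"
  unfolding gradient_def
proof (rule the_equality)
  fix g' assume "GDERIV f x :> g" "GDERIV f x :> g'"
  then have "(\<lambda>h. h \<bullet> g) = (\<lambda>h. h \<bullet> g')"
    unfolding gderiv_def by (rule has_derivative_unique)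
  then show "g' = g"
    by (metis vector_eq_ldot)
qed

context
  fixes A :: "real ^ 'n ^ 'm" and b :: "real ^ 'm" and c :: "real ^ 'n" and \<gamma> :: real
  assumes \<gamma>: "\<gamma> > 0"
begin

abbreviation (input) "weight \<equiv> softmax (\<lambda>j. column j A) (($) c) \<gamma>"
abbreviation (input) "dev \<equiv> deviation (\<lambda>j. column j A) (($) c) \<gamma>"
abbreviation (input) "mean \<equiv> softmax_mean (\<lambda>j. column j A) (($) c) \<gamma>"

lemma lse_dual_GDERIV: "GDERIV (lse_dual A b c \<gamma>) y :> mean y - b"
proof -
  let ?Z = "\<lambda>y. \<Sum>k\<in>UNIV. exp ((column k A \<bullet> y - c $ k) / \<gamma>)"
  have Z: "?Z y > 0"
    by (rule sum_exp_pos)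
  have dZ: "(?Z has_derivative (\<lambda>h. ?Z y * (mean y \<bullet> h) / \<gamma>)) (at y)"
    by (rule sum_exp_has_derivative)
  have "((\<lambda>y. - (b \<bullet> y) + \<gamma> * ln (?Z y)) has_derivative
     (\<lambda>h. - (b \<bullet> h) + \<gamma> * (?Z y * (mean y \<bullet> h) / \<gamma> * inverse (?Z y)))) (at y)"
    by (intro has_derivative_add has_derivative_minus has_derivative_inner_right has_derivative_ident
        has_derivative_mult_right has_derivative_ln Z dZ)
  moreover have "- (b \<bullet> h) + \<gamma> * (?Z y * (mean y \<bullet> h) / \<gamma> * inverse (?Z y)) = h \<bullet> (mean y - b)" for h
    using Z \<gamma> by (simp add: inner_diff_right inner_commute field_simps)
  ultimately show ?thesis
    by (simp add: gderiv_def lse_dual_def[abs_def])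
qed

lemma gradient_lse_dual: "gradient (lse_dual A b c \<gamma>) = (\<lambda>y. mean y - b)"
  by (rule ext, rule gradient_eqI, rule lse_dual_GDERIV)

lemma gradient_lse_dual_has_derivative:
  "(gradient (lse_dual A b c \<gamma>) has_derivative
    (\<lambda>h. \<Sum>j\<in>UNIV. (weight y j * (dev y j \<bullet> h) / \<gamma>) *\<^sub>R dev y j)) (at y)"
  unfolding gradient_lse_dual
  using has_derivative_diff[OF softmax_mean_has_derivative has_derivative_const] by simp

lemma hessian_lse_dual:
  "hessian (lse_dual A b c \<gamma>)
    = (\<lambda>y. \<Sum>j\<in>UNIV. (weight y j / \<gamma>) *\<^sub>R outer_product (dev y j) (dev y j))"
proof
  fix y
  let ?H = "\<Sum>j\<in>UNIV. (weight y j / \<gamma>) *\<^sub>R outer_product (dev y j) (dev y j)"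
  have "(\<lambda>h. \<Sum>j\<in>UNIV. (weight y j * (dev y j \<bullet> h) / \<gamma>) *\<^sub>R dev y j) = (*v) ?H"
    by (rule ext) (simp add: sum_outer_product_mult_vec)
  then have "frechet_derivative (gradient (lse_dual A b c \<gamma>)) (at y) = (*v) ?H"
    using frechet_derivative_at[OF gradient_lse_dual_has_derivative[of y]] by simp
  then show "hessian (lse_dual A b c \<gamma>) y = ?H"
    by (simp add: hessian_def jacobian_def)
qed

lemma hessian_form_lse_dual:
  "u \<bullet> (hessian (lse_dual A b c \<gamma>) y *v v)
    = (\<Sum>j\<in>UNIV. weight y j * ((dev y j \<bullet> u) * (dev y j \<bullet> v))) / \<gamma>"
  by (simp add: hessian_lse_dual inner_sum_outer_product_mult_vec sum_divide_distrib)

text \<open>Besides the derivative of the weights, the product rule yields terms in which the mean inside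
  one of the two deviations is differentiated. That derivative does not depend on \<open>j\<close>, so these
  terms carry the factor \<open>\<Sum>\<^sub>j p\<^sub>j d\<^sub>j = 0\<close>, and only the third central moment remains.\<close>

lemma hessian_lse_dual_has_derivative:
  "(hessian (lse_dual A b c \<gamma>) has_derivative
    (\<lambda>w. \<Sum>j\<in>UNIV. (weight y j * (dev y j \<bullet> w) / \<gamma>\<^sup>2) *\<^sub>R outer_product (dev y j) (dev y j))) (at y)"
proof -
  interpret bounded_bilinear "outer_product :: real ^ 'm \<Rightarrow> _"
    by (rule bounded_bilinear_outer_product)
  \<comment> \<open>the derivative of the softmax mean\<close>
  define M where "M h = (\<Sum>j\<in>UNIV. (weight y j * (dev y j \<bullet> h) / \<gamma>) *\<^sub>R dev y j)" for h
  have "((\<lambda>y. \<Sum>j\<in>UNIV. (weight y j / \<gamma>) *\<^sub>R outer_product (dev y j) (dev y j)) has_derivative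
      (\<lambda>h. \<Sum>j\<in>UNIV. (weight y j / \<gamma>) *\<^sub>R
             (outer_product (dev y j) (- M h) + outer_product (- M h) (dev y j))
           + (weight y j * (dev y j \<bullet> h) / \<gamma> / \<gamma>) *\<^sub>R outer_product (dev y j) (dev y j))) (at y)"
    unfolding M_def using \<gamma>
    by (intro has_derivative_sum has_derivative_scaleR FDERIV deviation_has_derivative)
      (auto intro!: derivative_eq_intros softmax_has_derivative)
  moreover have "(\<Sum>j\<in>UNIV. (weight y j / \<gamma>) *\<^sub>R
             (outer_product (dev y j) (- M h) + outer_product (- M h) (dev y j))
           + (weight y j * (dev y j \<bullet> h) / \<gamma> / \<gamma>) *\<^sub>R outer_product (dev y j) (dev y j))
      = (\<Sum>j\<in>UNIV. (weight y j * (dev y j \<bullet> h) / \<gamma>\<^sup>2) *\<^sub>R outer_product (dev y j) (dev y j))" for h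
  proof -
    have centred: "(\<Sum>j\<in>UNIV. (weight y j / \<gamma>) *\<^sub>R dev y j) = 0"
      using sum_softmax_deviation[of "\<lambda>j. column j A" "($) c" \<gamma> y]
      by (simp add: divide_inverse_commute flip: scaleR_scaleR scaleR_sum_right)
    have "(\<Sum>j\<in>UNIV. (weight y j / \<gamma>) *\<^sub>R
             (outer_product (dev y j) (- M h) + outer_product (- M h) (dev y j)))
        = outer_product (\<Sum>j\<in>UNIV. (weight y j / \<gamma>) *\<^sub>R dev y j) (- M h)
          + outer_product (- M h) (\<Sum>j\<in>UNIV. (weight y j / \<gamma>) *\<^sub>R dev y j)"
      by (simp add: scaleR_add_right sum.distrib sum_left sum_right scaleR_left scaleR_right)
    also have "\<dots> = 0"
      by (simp add: centred zero_left zero_right)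
    finally show ?thesis
      by (simp add: sum.distrib power2_eq_square)
  qed
  ultimately show ?thesis
    unfolding hessian_lse_dual by simp
qed

lemma third_derivative_lse_dual:
  "third_derivative (lse_dual A b c \<gamma>) y u v w
    = (\<Sum>j\<in>UNIV. weight y j * (dev y j \<bullet> w) * ((dev y j \<bullet> u) * (dev y j \<bullet> v))) / \<gamma>\<^sup>2"
  unfolding third_derivative_def frechet_derivative_at[OF hessian_lse_dual_has_derivative, symmetric]
  by (simp add: inner_sum_outer_product_mult_vec sum_divide_distrib)

lemma C3_lse_dual: "C3 (lse_dual A b c \<gamma>)"
  unfolding C3_def
proof (intro conjI allI)
  fix y
  show "lse_dual A b c \<gamma> differentiable at y"
    using lse_dual_GDERIV unfolding gderiv_def by (rule differentiableI)
  show "gradient (lse_dual A b c \<gamma>) differentiable at y"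
    by (rule differentiableI, rule gradient_lse_dual_has_derivative)
  show "hessian (lse_dual A b c \<gamma>) differentiable at y"
    by (rule differentiableI, rule hessian_lse_dual_has_derivative)
next
  fix u v w
  have "continuous_on UNIV (\<lambda>y. weight y j)" for j
    by (intro continuous_at_imp_continuous_on ballI has_derivative_continuous[OF softmax_has_derivative])
  moreover have "continuous_on UNIV (\<lambda>y. dev y j)" for j
    by (intro continuous_at_imp_continuous_on ballI has_derivative_continuous[OF deviation_has_derivative])
  ultimately show "continuous_on UNIV (\<lambda>y. third_derivative (lse_dual A b c \<gamma>) y u v w)"
    unfolding third_derivative_lse_dual using \<gamma> by (intro continuous_intros) auto
qed

text \<open>The tangent plane at \<open>x\<close> lies below the graph: the ratio of the partition functions at
  \<open>y\<close> and \<open>x\<close> is the expectation of \<open>exp (a\<^sub>j \<bullet> (y - x) / \<gamma>)\<close> under the weights at \<open>x\<close>,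
  and Jensen's inequality bounds it below by \<open>exp (\<mu> \<bullet> (y - x) / \<gamma>)\<close>. Jensen's inequality
  amounts here to \<open>1 + t \<le> exp t\<close> for the centred exponents, whose expectation is zero.\<close>

lemma convex_on_lse_dual: "convex_on UNIV (lse_dual A b c \<gamma>)"
proof (rule convex_on_UNIV_if_supporting_hyperplanes)
  fix x y
  let ?e = "\<lambda>y k. exp ((column k A \<bullet> y - c $ k) / \<gamma>)"
  let ?Z = "\<lambda>y. \<Sum>k\<in>UNIV. ?e y k"
  let ?z = "\<lambda>k. (column k A \<bullet> (y - x)) / \<gamma>" and ?m = "(mean x \<bullet> (y - x)) / \<gamma>"
  have Z: "?Z x > 0" "?Z y > 0"
    by (rule sum_exp_pos)+
  have "exp ?m = exp ?m * (\<Sum>k\<in>UNIV. weight x k * (1 + (dev x k \<bullet> (y - x)) / \<gamma>))"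
  proof -
    have "(\<Sum>k\<in>UNIV. weight x k * (1 + (dev x k \<bullet> (y - x)) / \<gamma>))
        = 1 + ((\<Sum>k\<in>UNIV. weight x k *\<^sub>R dev x k) \<bullet> (y - x)) / \<gamma>"
      by (simp add: distrib_left sum.distrib sum_softmax inner_sum_left sum_divide_distrib)
    then show ?thesis
      by (simp add: sum_softmax_deviation)
  qed
  also have "\<dots> \<le> exp ?m * (\<Sum>k\<in>UNIV. weight x k * exp ((dev x k \<bullet> (y - x)) / \<gamma>))"
    by (intro mult_left_mono sum_mono exp_ge_add_one_self) (auto simp: softmax_pos less_imp_le)
  also have "\<dots> = (\<Sum>k\<in>UNIV. weight x k * exp (?z k))"
    unfolding sum_distrib_left
    by (intro sum.cong refl)
      (simp add: deviation_def inner_diff_left diff_divide_distrib exp_diff)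
  also have "\<dots> = ?Z y / ?Z x"
  proof -
    have "?e x k * exp (?z k) = ?e y k" for k
      by (simp add: inner_diff_right add_divide_distrib diff_divide_distrib flip: exp_add)
    then show ?thesis
      by (simp add: softmax_def flip: sum_divide_distrib)
  qed
  finally have "?Z x * exp ?m \<le> ?Z y"
    using Z by (simp add: field_simps)
  then have "ln (?Z x * exp ?m) \<le> ln (?Z y)"
    using Z by simp
  then have "ln (?Z x) + ?m \<le> ln (?Z y)"
    using Z by (simp add: ln_mult)
  then have "\<gamma> * (ln (?Z x) + ?m) \<le> \<gamma> * ln (?Z y)"
    using \<gamma> by simp
  then show "lse_dual A b c \<gamma> x + (mean x - b) \<bullet> (y - x) \<le> lse_dual A b c \<gamma> y"
    using \<gamma> by (simp add: lse_dual_def distrib_left inner_diff_left inner_diff_right)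
qed

section \<open>Smoothness constants of the log-sum-exp dual\<close>

lemma abs_hessian_form_lse_dual_le:
  "\<bar>u \<bullet> (hessian (lse_dual A b c \<gamma>) y *v v)\<bar> \<le> (column_diameter A)\<^sup>2 / (4 * \<gamma>) * norm u * norm v"
proof -
  have "\<bar>\<Sum>j\<in>UNIV. weight y j * ((dev y j \<bullet> u) * (dev y j \<bullet> v))\<bar>
      \<le> (\<Sum>j\<in>UNIV. weight y j * \<bar>(dev y j \<bullet> u) * (dev y j \<bullet> v)\<bar>)"
    by (rule order_trans[OF sum_abs]) (simp add: abs_mult softmax_pos less_imp_le)
  also have "\<dots> \<le> (column_diameter A)\<^sup>2 / 4 * norm u * norm v"
    by (rule softmax_abs_covariance_le) (rule norm_column_diff_le_column_diameter)
  finally show ?thesis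
    using \<gamma> unfolding hessian_form_lse_dual by (simp add: divide_simps mult_ac)
qed

lemma spectral_norm_hessian_lse_dual_le:
  "spectral_norm (hessian (lse_dual A b c \<gamma>) y) \<le> (column_diameter A)\<^sup>2 / (4 * \<gamma>)"
  by (intro spectral_norm_le_bilinear abs_hessian_form_lse_dual_le)

lemma abs_third_derivative_lse_dual_le:
  "\<bar>third_derivative (lse_dual A b c \<gamma>) y u v w\<bar>
    \<le> column_diameter A ^ 3 / (4 * \<gamma>\<^sup>2) * norm u * norm v * norm w"
proof -
  have "\<bar>\<Sum>j\<in>UNIV. weight y j * (dev y j \<bullet> w) * ((dev y j \<bullet> u) * (dev y j \<bullet> v))\<bar>
      \<le> column_diameter A * norm w * (\<Sum>j\<in>UNIV. weight y j * \<bar>(dev y j \<bullet> u) * (dev y j \<bullet> v)\<bar>)"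
    by (rule softmax_third_moment_le) (rule norm_column_diff_le_column_diameter)
  also have "\<dots> \<le> column_diameter A * norm w * ((column_diameter A)\<^sup>2 / 4 * norm u * norm v)"
    by (intro mult_left_mono softmax_abs_covariance_le norm_column_diff_le_column_diameter
        mult_nonneg_nonneg column_diameter_nonneg norm_ge_zero)
  finally show ?thesis
    using \<gamma> unfolding third_derivative_lse_dual
    by (simp add: divide_simps power2_eq_square power3_eq_cube mult_ac)
qed

lemma abs_third_derivative_lse_dual_le_hessian:
  "\<bar>third_derivative (lse_dual A b c \<gamma>) y u u v\<bar>
    \<le> column_diameter A / \<gamma> * (u \<bullet> (hessian (lse_dual A b c \<gamma>) y *v u)) * norm v"
proof -
  have "\<bar>\<Sum>j\<in>UNIV. weight y j * (dev y j \<bullet> v) * ((dev y j \<bullet> u) * (dev y j \<bullet> u))\<bar>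
      \<le> column_diameter A * norm v * (\<Sum>j\<in>UNIV. weight y j * \<bar>(dev y j \<bullet> u) * (dev y j \<bullet> u)\<bar>)"
    by (rule softmax_third_moment_le) (rule norm_column_diff_le_column_diameter)
  then show ?thesis
    using \<gamma> unfolding third_derivative_lse_dual hessian_form_lse_dual
    by (simp add: divide_simps power2_eq_square mult_ac)
qed

lemma gradient_lse_dual_lipschitz:
  "((column_diameter A)\<^sup>2 / (4 * \<gamma>))-lipschitz_on UNIV (gradient (lse_dual A b c \<gamma>))"
proof (rule lipschitz_onI)
  fix x y
  have "(gradient (lse_dual A b c \<gamma>) has_derivative (*v) (hessian (lse_dual A b c \<gamma>) z)) (at z)" for z
    by (rule has_derivative_eq_rhs[OF gradient_lse_dual_has_derivative])
      (simp add: hessian_lse_dual sum_outer_product_mult_vec fun_eq_iff)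
  then have "norm (gradient (lse_dual A b c \<gamma>) x - gradient (lse_dual A b c \<gamma>) y)
      \<le> (column_diameter A)\<^sup>2 / (4 * \<gamma>) * norm (x - y)"
    using spectral_norm_hessian_lse_dual_le
    by (intro differentiable_bound[of UNIV _ "\<lambda>z. (*v) (hessian (lse_dual A b c \<gamma>) z)"])
      (auto simp: spectral_norm_def)
  then show "dist (gradient (lse_dual A b c \<gamma>) x) (gradient (lse_dual A b c \<gamma>) y)
      \<le> (column_diameter A)\<^sup>2 / (4 * \<gamma>) * dist x y"
    by (simp add: dist_norm)
qed (use \<gamma> in auto)

text \<open>The mean value inequality is applied to the scalar functions \<open>z \<mapsto> u \<bullet> H(z) v\<close> for fixed
  \<open>u, v\<close>. Applied to the matrix-valued map \<open>H\<close> it would measure the increments in the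
  Frobenius norm, and the constant would depend on the dimension.\<close>

lemma hessian_lipschitz_lse_dual:
  "hessian_lipschitz (column_diameter A ^ 3 / (4 * \<gamma>\<^sup>2)) (lse_dual A b c \<gamma>)"
  unfolding hessian_lipschitz_def
proof (intro conjI allI)
  show "0 \<le> column_diameter A ^ 3 / (4 * \<gamma>\<^sup>2)"
    by (simp add: column_diameter_nonneg)
  fix x y
  let ?H = "hessian (lse_dual A b c \<gamma>)" and ?K = "column_diameter A ^ 3 / (4 * \<gamma>\<^sup>2)"
  show "spectral_norm (?H x - ?H y) \<le> ?K * norm (x - y)"
  proof (rule spectral_norm_le_bilinear)
    fix u v
    have lin: "bounded_linear (\<lambda>M :: real ^ 'm ^ 'm. u \<bullet> (M *v v))"
      by (intro linear_conv_bounded_linear[THEN iffD1] linearI)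
        (simp_all add: matrix_vector_mult_add_rdistrib inner_add_right flip: scaleR_matrix_vector_assoc)
    have "((\<lambda>z. u \<bullet> (?H z *v v)) has_derivative third_derivative (lse_dual A b c \<gamma>) z u v) (at z)" for z
      using bounded_linear.has_derivative[OF lin hessian_lse_dual_has_derivative[of z]]
      unfolding third_derivative_def[abs_def]
        frechet_derivative_at[OF hessian_lse_dual_has_derivative[of z], symmetric] .
    moreover have "onorm (third_derivative (lse_dual A b c \<gamma>) z u v) \<le> ?K * norm u * norm v" for z
      by (rule onorm_le) (simp only: real_norm_def abs_third_derivative_lse_dual_le)
    ultimately have "norm (u \<bullet> (?H x *v v) - u \<bullet> (?H y *v v)) \<le> ?K * norm u * norm v * norm (x - y)"
      by (intro differentiable_bound[of UNIV _ "\<lambda>z. third_derivative (lse_dual A b c \<gamma>) z u v"]) auto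
    then show "\<bar>u \<bullet> ((?H x - ?H y) *v v)\<bar> \<le> ?K * norm (x - y) * norm u * norm v"
      by (simp add: matrix_vector_mult_diff_rdistrib inner_diff_right mult_ac)
  qed
qed

end

theorem theorem5p1:
  fixes A :: "real ^ 'n ^ 'm" and b :: "real ^ 'm" and c :: "real ^ 'n" and \<gamma> :: real
  assumes "\<gamma> > 0"
    and "\<exists>q. transpose A *v q = (\<chi> j. 1) \<and> q \<bullet> b = 1"
    and "\<exists>x. (\<forall>j. x $ j > 0) \<and> A *v x = b"
  defines "\<phi> \<equiv> lse_dual A b c \<gamma>" and "\<Delta> \<equiv> column_diameter A"
  shows "C3 \<phi> \<and>
    (\<forall>y u v w.
      spectral_norm (hessian \<phi> y) \<le> \<Delta>\<^sup>2 / (4 * \<gamma>) \<and>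
      \<bar>third_derivative \<phi> y u v w\<bar> \<le> \<Delta> ^ 3 / (4 * \<gamma>\<^sup>2) * norm u * norm v * norm w \<and>
      \<bar>third_derivative \<phi> y u u v\<bar> \<le> \<Delta> / \<gamma> * (u \<bullet> (hessian \<phi> y *v u)) * norm v) \<and>
    (\<Delta>\<^sup>2 / (4 * \<gamma>))-lipschitz_on UNIV (gradient \<phi>) \<and>
    quasi_self_concordant (\<Delta> / \<gamma>) \<phi> \<and>
    hessian_lipschitz (\<Delta> ^ 3 / (4 * \<gamma>\<^sup>2)) \<phi>"
  unfolding \<phi>_def \<Delta>_def quasi_self_concordant_def
  by (intro conjI allI C3_lse_dual convex_on_lse_dual spectral_norm_hessian_lse_dual_le
      abs_third_derivative_lse_dual_le abs_third_derivative_lse_dual_le_hessian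
      gradient_lse_dual_lipschitz hessian_lipschitz_lse_dual \<open>\<gamma> > 0\<close>)

end
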